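(* Let $p\in(0,1)$ and $s\in(1,\infty)$. For every $\bar u\in L^s(\Omega)$, \[ \partial q_{s,p}(\bar u)=\widehat{\partial} q_{s,p}(\bar u)=\{\eta\in L^r(\Omega) : \eta=p\,|\bar u|^{p-2}\bar u \text{ a.e. on } \{\bar u\neq 0\}\}. \]
   Context: $\Omega\subset\mathbb{R}^d$ is a Lebesgue-measurable set with positive and finite Lebesgue measure. For $s\in(1,\infty)$, $r\in(1,\infty)$ is given by $\frac1s+\frac1r=1$, and $L^r(\Omega)$ is identified with the dual of $L^s(\Omega)$. For measurable $u$, $\{u\neq0\}:=\{x\in\Omega : u(x)\neq 0\}$ (defined up to null sets). For $p\in(0,1)$ the functional $q_{s,p}\colon L^s(\Omega)\to\mathbb{R}$ is $q_{s,p}(u):=\int_\Omega |u(x)|^p\,\mathrm{d}x$. The Fréchet subdifferential of $q_{s,p}$ at $u\in L^s(\Omega)$ is \[ \widehat{\partial} q_{s,p}(u):=\Bigl\{\eta\in L^r(\Omega) : \liminf_{\Vert h\Vert_s\searrow 0}\frac{q_{s,p}(u+h)-q_{s,p}(u)-\int_\Omega\eta(x)h(x)\,\mathrm{d}x}{\Vert h\Vert_s}\ge 0\Bigr\}, \] where the lower limit is over $h\in L^s(\Omega)\setminus\{0\}$ with $\Vert h\Vert_s\to 0$. The limiting (Mordukhovich) subdifferential $\partial q_{s,p}(\bar u)$ is the set of all $\eta\in L^r(\Omega)$ for which there exist sequences $\{u_k\}_{k\in\mathbb{N}}\subset L^s(\Omega)$ and $\{\eta_k\}_{k\in\mathbb{N}}\subset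 L^r(\Omega)$ such that $u_k\to\bar u$ in $L^s(\Omega)$, $q_{s,p}(u_k)\to q_{s,p}(\bar u)$, $\eta_k\rightharpoonup\eta$ weakly in $L^r(\Omega)$, and $\eta_k\in\widehat{\partial} q_{s,p}(u_k)$ for all $k\in\mathbb{N}$. *)

theory Defs
  imports "HOL-Analysis.Analysis"
begin

text \<open>
  Elements of a Lebesgue space are represented by functions, not by classes of functions that
  agree almost everywhere; \<open>L^s(\<Omega>)\<close> is \<open>Leb_space (lebesgue_on \<Omega>) s\<close>. The notions below do
  not depend on the choice of representatives (for the subdifferentials, whenever the functional
  does not).
\<close>

definition Leb_space :: "'a measure \<Rightarrow> real \<Rightarrow> ('a \<Rightarrow> real) set" where
  "Leb_space M s = {f \<in> borel_measurable M. integrable M (\<lambda>x. \<bar>f x\<bar> powr s)}"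

definition Leb_norm :: "'a measure \<Rightarrow> real \<Rightarrow> ('a \<Rightarrow> real) \<Rightarrow> real" where
  "Leb_norm M s f = (\<integral>x. \<bar>f x\<bar> powr s \<partial>M) powr (1 / s)"

definition Leb_converges :: "'a measure \<Rightarrow> real \<Rightarrow> (nat \<Rightarrow> 'a \<Rightarrow> real) \<Rightarrow> ('a \<Rightarrow> real) \<Rightarrow> bool" where
  "Leb_converges M s U u \<longleftrightarrow> (\<lambda>k. Leb_norm M s (\<lambda>x. U k x - u x)) \<longlonglongrightarrow> 0"

text \<open>
  The topological dual. The bound makes \<open>\<phi>\<close> insensitive to changes on null sets; its
  values outside \<open>Leb_space M r\<close> are irrelevant.
\<close>

definition Leb_dual :: "'a measure \<Rightarrow> real \<Rightarrow> (('a \<Rightarrow> real) \<Rightarrow> real) set" where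
  "Leb_dual M r = {\<phi>.
     (\<forall>f\<in>Leb_space M r. \<forall>g\<in>Leb_space M r. \<phi> (\<lambda>x. f x + g x) = \<phi> f + \<phi> g) \<and>
     (\<forall>c. \<forall>f\<in>Leb_space M r. \<phi> (\<lambda>x. c * f x) = c * \<phi> f) \<and>
     (\<exists>C. \<forall>f\<in>Leb_space M r. \<bar>\<phi> f\<bar> \<le> C * Leb_norm M r f)}"

definition Leb_converges_weakly ::
    "'a measure \<Rightarrow> real \<Rightarrow> (nat \<Rightarrow> 'a \<Rightarrow> real) \<Rightarrow> ('a \<Rightarrow> real) \<Rightarrow> bool" where
  "Leb_converges_weakly M r H \<eta> \<longleftrightarrow> (\<forall>\<phi>\<in>Leb_dual M r. (\<lambda>k. \<phi> (H k)) \<longlonglongrightarrow> \<phi> \<eta>)"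

text \<open>
  The filter of \<open>h\<close> in \<open>L^s\<close>, \<open>h \<noteq> 0\<close>, with norm tending to \<open>0\<close>. As \<open>at_right 0\<close>
  only sees positive norms, functions vanishing almost everywhere are excluded.
\<close>

definition Leb_at_0 :: "'a measure \<Rightarrow> real \<Rightarrow> ('a \<Rightarrow> real) filter" where
  "Leb_at_0 M s = inf (filtercomap (Leb_norm M s) (at_right 0)) (principal (Leb_space M s))"

text \<open>
  Subdifferentials of a functional \<open>J\<close> on \<open>L^s\<close>; \<open>r\<close> is the exponent conjugate to \<open>s\<close>.
  The lower limit is taken in the extended reals.
\<close>

definition frechet_subdiff ::
    "'a measure \<Rightarrow> real \<Rightarrow> real \<Rightarrow> (('a \<Rightarrow> real) \<Rightarrow> real) \<Rightarrow> ('a \<Rightarrow> real) \<Rightarrow> ('a \<Rightarrow> real) set" where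
  "frechet_subdiff M s r J u = {\<eta> \<in> Leb_space M r.
     Liminf (Leb_at_0 M s)
       (\<lambda>h. ereal ((J (\<lambda>x. u x + h x) - J u - (\<integral>x. \<eta> x * h x \<partial>M)) / Leb_norm M s h)) \<ge> 0}"

definition limiting_subdiff ::
    "'a measure \<Rightarrow> real \<Rightarrow> real \<Rightarrow> (('a \<Rightarrow> real) \<Rightarrow> real) \<Rightarrow> ('a \<Rightarrow> real) \<Rightarrow> ('a \<Rightarrow> real) set" where
  "limiting_subdiff M s r J u = {\<eta> \<in> Leb_space M r.
     \<exists>U H. (\<forall>k. U k \<in> Leb_space M s) \<and> (\<forall>k. H k \<in> Leb_space M r) \<and>
       Leb_converges M s U u \<and> (\<lambda>k. J (U k)) \<longlonglongrightarrow> J u \<and>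
       Leb_converges_weakly M r H \<eta> \<and>
       (\<forall>k. H k \<in> frechet_subdiff M s r J (U k))}"

definition q_fun :: "'a measure \<Rightarrow> real \<Rightarrow> ('a \<Rightarrow> real) \<Rightarrow> real" where
  "q_fun M p u = (\<integral>x. \<bar>u x\<bar> powr p \<partial>M)"

end

theory Submission
  imports Defs
begin

text \<open>
  The pointwise inequality \<open>\<bar>\<bar>a + h\<bar>\<^sup>p - \<bar>a\<bar>\<^sup>p\<bar> \<le> \<bar>a\<bar>\<^sup>p\<^sup>-\<^sup>1 \<bar>h\<bar>\<close> drives everything.
  If \<open>\<eta> = p \<bar>u\<bar>\<^sup>p\<^sup>-\<^sup>2 u\<close> on \<open>{u \<noteq> 0}\<close>, it shows that the negative part of
  \<open>\<bar>u + h\<bar>\<^sup>p - \<bar>u\<bar>\<^sup>p - \<eta> h\<close>, divided by \<open>\<bar>h\<bar>\<close>, is at most \<open>(1 + 1/p) \<bar>\<eta>\<bar> \<in> L^r\<close>; as this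
  quotient tends to \<open>0\<close> with \<open>h\<close>, its \<open>L^r\<close> norm does too by dominated convergence along almost
  everywhere convergent subsequences, and Hoelder's inequality makes \<open>\<eta>\<close> a Frechet subgradient.
  Conversely, perturbing \<open>u\<close> only where \<open>\<bar>u\<bar> \<ge> 1/n\<close> makes the functional directionally
  differentiable, which forces the formula for \<open>\<eta>\<close>. The formula survives weak limits because
  the subgradients \<open>p \<bar>u\<^sub>k\<bar>\<^sup>p\<^sup>-\<^sup>2 u\<^sub>k\<close> converge boundedly on the sets where all late \<open>\<bar>u\<^sub>k\<bar>\<close> stay
  above \<open>1/N\<close>, and these sets exhaust \<open>{u \<noteq> 0}\<close>.
\<close>

section \<open>Pointwise estimates for the power \<open>\<bar>a\<bar> powr p\<close>\<close>

lemma abs_powr_diff_bound: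
  fixes a h p :: real
  assumes "0 < p" "p < 1" "a \<noteq> 0"
  shows "\<bar>\<bar>a + h\<bar> powr p - \<bar>a\<bar> powr p\<bar> \<le> \<bar>a\<bar> powr (p - 1) * \<bar>h\<bar>"
proof -
  \<comment> \<open>Scaling by \<open>\<bar>a\<bar>\<close> leaves one variable: the upper bound
    comes from \<open>(1 + t) powr p \<le> 1 + t\<close>, the lower one from
    \<open>1 - t \<le> (1 - t) powr p\<close> for \<open>t \<le> 1\<close>, and for
    \<open>t > 1\<close> its left-hand side is negative.\<close>
  define t where "t = \<bar>h\<bar> / \<bar>a\<bar>"
  have t: "t \<ge> 0" "\<bar>h\<bar> = \<bar>a\<bar> * t" using assms by (auto simp: t_def)
  have ap: "\<bar>a\<bar> powr p > 0" using assms by simp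
  have sc: "\<bar>a\<bar> powr (p - 1) * \<bar>h\<bar> = \<bar>a\<bar> powr p * t"
    using assms by (simp add: t_def powr_diff)
  have "\<bar>a + h\<bar> powr p \<le> (\<bar>a\<bar> * (1 + t)) powr p"
    using t assms by (intro powr_mono2) (auto simp: algebra_simps)
  also have "\<dots> = \<bar>a\<bar> powr p * (1 + t) powr p" using t by (simp add: powr_mult)
  also have "\<dots> \<le> \<bar>a\<bar> powr p * (1 + t)"
    using powr_mono[of p 1 "1 + t"] t assms by (intro mult_left_mono) auto
  finally have up: "\<bar>a + h\<bar> powr p - \<bar>a\<bar> powr p \<le> \<bar>a\<bar> powr p * t" by (simp add: algebra_simps)
  have lo: "\<bar>a\<bar> powr p * (1 - t) \<le> \<bar>a + h\<bar> powr p"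
  proof (cases "t \<le> 1")
    case True
    have "\<bar>a\<bar> powr p * (1 - t) \<le> \<bar>a\<bar> powr p * (1 - t) powr p"
    proof (intro mult_left_mono)
      show "1 - t \<le> (1 - t) powr p"
        using powr_mono'[of p 1 "1 - t"] t assms True by simp
    qed simp
    also have "\<dots> = (\<bar>a\<bar> * (1 - t)) powr p" using True by (simp add: powr_mult)
    also have "\<dots> \<le> \<bar>a + h\<bar> powr p"
      using t assms True by (intro powr_mono2) (auto simp: algebra_simps)
    finally show ?thesis .
  next
    case False
    then have "\<bar>a\<bar> powr p * (1 - t) \<le> 0" by (intro mult_nonneg_nonpos) auto
    then show ?thesis by (smt (verit) powr_ge_zero)
  qed
  show ?thesis unfolding sc using up lo by (auto simp: abs_le_iff algebra_simps)
qed

lemma has_real_derivative_abs_powr: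
  fixes a p :: real
  assumes "a \<noteq> 0"
  shows "((\<lambda>x. \<bar>x\<bar> powr p) has_real_derivative p * \<bar>a\<bar> powr (p - 2) * a) (at a)"
proof -
  have "(abs has_real_derivative sgn a) (at a)"
  proof (cases "a > 0")
    case True
    show ?thesis
      by (rule has_field_derivative_transform_within_open[of "\<lambda>x. x" _ a "{0<..}"])
        (use True in auto)
  next
    case False
    show ?thesis
      by (rule has_field_derivative_transform_within_open[of uminus _ a "{..<0}"])
        (use False assms in \<open>auto intro!: derivative_eq_intros\<close>)
  qed
  then have "((\<lambda>x. \<bar>x\<bar> powr p) has_real_derivative p * \<bar>a\<bar> powr (p - 1) * sgn a) (at a)"
    using assms by (auto intro!: derivative_eq_intros)
  moreover have "\<bar>a\<bar> powr (p - 1) * sgn a = \<bar>a\<bar> powr (p - 2) * a"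
  proof -
    have "\<bar>a\<bar> powr (p - 1) = \<bar>a\<bar> powr (p - 2) * \<bar>a\<bar>"
      using assms powr_add[of "\<bar>a\<bar>" "p - 2" 1] by simp
    then show ?thesis by (simp add: abs_mult_sgn mult.assoc)
  qed
  ultimately show ?thesis by (simp add: mult.assoc)
qed

text \<open>The negative part of the first-order defect of the power function at \<open>a\<close>
  with slope \<open>e\<close>, per unit of \<open>\<bar>h\<bar>\<close>. Division by zero gives the
  value 0 at \<open>h = 0\<close>, which is also the limit there, so the estimates below need no
  exception at that point.\<close>

definition neg_quotient :: "real \<Rightarrow> real \<Rightarrow> real \<Rightarrow> real \<Rightarrow> real" where
  "neg_quotient p a e h = max 0 (\<bar>a\<bar> powr p + e * h - \<bar>a + h\<bar> powr p) / \<bar>h\<bar>"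

lemma neg_quotient_nonneg: "neg_quotient p a e h \<ge> 0"
  by (simp add: neg_quotient_def)

lemma neg_quotient_ge:
  "- (neg_quotient p a e h * \<bar>h\<bar>) \<le> \<bar>a + h\<bar> powr p - \<bar>a\<bar> powr p - e * h"
  by (cases "h = 0") (auto simp: neg_quotient_def)

text \<open>For \<open>a \<noteq> 0\<close> the slope satisfies
  \<open>\<bar>e\<bar> = p * \<bar>a\<bar> powr (p - 1)\<close>, so the Lipschitz-type bound on the
  power reads \<open>\<bar>e\<bar> / p\<close> per unit of \<open>\<bar>h\<bar>\<close>. For
  \<open>a = 0\<close> the power can only increase, and the linear term alone is left.\<close>

lemma neg_quotient_le:
  assumes "0 < p" "p < 1" "a \<noteq> 0 \<longrightarrow> e = p * \<bar>a\<bar> powr (p - 2) * a"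
  shows "neg_quotient p a e h \<le> (1 + 1 / p) * \<bar>e\<bar>"
proof (cases "h = 0")
  case True
  then show ?thesis using assms by (simp add: neg_quotient_def)
next
  case False
  have eh: "e * h \<le> \<bar>e\<bar> * \<bar>h\<bar>" by (metis abs_ge_self abs_mult)
  have "\<bar>a\<bar> powr p + e * h - \<bar>a + h\<bar> powr p \<le> (1 + 1 / p) * \<bar>e\<bar> * \<bar>h\<bar>"
  proof (cases "a = 0")
    case True
    have "0 \<le> 1 / p * \<bar>e\<bar> * \<bar>h\<bar>" using assms by simp
    moreover have "e * h - \<bar>h\<bar> powr p \<le> \<bar>e\<bar> * \<bar>h\<bar>"
      using eh powr_ge_zero[of "\<bar>h\<bar>" p] by linarith
    ultimately show ?thesis using True by (simp add: algebra_simps)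
  next
    case a: False
    have "\<bar>e\<bar> = p * (\<bar>a\<bar> powr (p - 2) * \<bar>a\<bar>)" using a assms by (simp add: abs_mult)
    also have "\<bar>a\<bar> powr (p - 2) * \<bar>a\<bar> = \<bar>a\<bar> powr (p - 1)"
      using a powr_add[of "\<bar>a\<bar>" "p - 2" 1] by simp
    finally have "\<bar>a\<bar> powr (p - 1) = 1 / p * \<bar>e\<bar>" using assms by simp
    then show ?thesis
      using abs_powr_diff_bound[OF assms(1,2) a, of h] eh
      by (simp add: algebra_simps abs_le_iff)
  qed
  moreover have "0 \<le> (1 + 1 / p) * \<bar>e\<bar> * \<bar>h\<bar>" using assms by simp
  ultimately show ?thesis using False by (simp add: neg_quotient_def pos_divide_le_eq)
qed

text \<open>At \<open>a \<noteq> 0\<close> this is differentiability. At \<open>a = 0\<close> the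
  slope is arbitrary: \<open>\<bar>h\<bar> powr p\<close> dominates \<open>e * h\<close> for small
  \<open>h\<close>, so the quotient is eventually 0. The filter is \<open>nhds 0\<close> rather than
  \<open>at 0\<close> because the perturbations inserted later may vanish at individual
  points.\<close>

lemma tendsto_neg_quotient:
  assumes "0 < p" "p < 1" "a \<noteq> 0 \<longrightarrow> e = p * \<bar>a\<bar> powr (p - 2) * a"
  shows "(neg_quotient p a e \<longlongrightarrow> 0) (nhds 0)"
proof -
  have "(neg_quotient p a e \<longlongrightarrow> 0) (at 0)"
  proof (cases "a = 0")
    case True
    have "((\<lambda>h. \<bar>h\<bar> powr (1 - p) * \<bar>e\<bar>) \<longlongrightarrow> 0 powr (1 - p) * \<bar>e\<bar>) (at (0::real))"
      using assms by (intro tendsto_intros tendsto_powr' ) (auto intro!: tendsto_eq_intros)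
    then have "eventually (\<lambda>h. \<bar>h\<bar> powr (1 - p) * \<bar>e\<bar> < 1) (at (0::real))"
      by (rule order_tendstoD) simp
    moreover have "eventually (\<lambda>h. h \<noteq> 0) (at (0::real))" by (simp add: eventually_at_filter)
    ultimately have "eventually (\<lambda>h. neg_quotient p a e h = 0) (at 0)"
    proof eventually_elim
      case (elim h)
      have "e * h \<le> \<bar>e\<bar> * \<bar>h\<bar>" by (metis abs_ge_self abs_mult)
      also have "\<bar>h\<bar> = \<bar>h\<bar> powr p * \<bar>h\<bar> powr (1 - p)"
        using elim by (simp flip: powr_add)
      also have "\<bar>e\<bar> * (\<bar>h\<bar> powr p * \<bar>h\<bar> powr (1 - p)) \<le> \<bar>h\<bar> powr p * 1"
        using mult_left_mono[OF less_imp_le[OF elim(1)], of "\<bar>h\<bar> powr p"] by (simp add: algebra_simps)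
      finally show ?case using True by (simp add: neg_quotient_def)
    qed
    then show ?thesis by (simp add: tendsto_eventually)
  next
    case False
    then have e: "e = p * \<bar>a\<bar> powr (p - 2) * a" using assms by simp
    have "((\<lambda>h. (\<bar>a + h\<bar> powr p - \<bar>a\<bar> powr p) / h) \<longlongrightarrow> e) (at 0)"
      using has_real_derivative_abs_powr[OF False, of p] unfolding DERIV_def e .
    then have "((\<lambda>h. \<bar>(\<bar>a + h\<bar> powr p - \<bar>a\<bar> powr p) / h - e\<bar>) \<longlongrightarrow> \<bar>e - e\<bar>) (at 0)"
      by (intro tendsto_intros)
    then have lim: "((\<lambda>h. \<bar>(\<bar>a + h\<bar> powr p - \<bar>a\<bar> powr p) / h - e\<bar>) \<longlongrightarrow> 0) (at 0)" by simp
    show ?thesis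
    proof (rule tendsto_sandwich[OF _ _ tendsto_const lim])
      show "\<forall>\<^sub>F h in at 0. neg_quotient p a e h \<le> \<bar>(\<bar>a + h\<bar> powr p - \<bar>a\<bar> powr p) / h - e\<bar>"
        unfolding eventually_at_filter
      proof (intro always_eventually allI impI)
        fix h :: real assume h: "h \<noteq> 0"
        have "(\<bar>a + h\<bar> powr p - \<bar>a\<bar> powr p) / h - e = (\<bar>a + h\<bar> powr p - \<bar>a\<bar> powr p - e * h) / h"
          using h by (simp add: field_simps)
        then show "neg_quotient p a e h \<le> \<bar>(\<bar>a + h\<bar> powr p - \<bar>a\<bar> powr p) / h - e\<bar>"
          by (simp add: neg_quotient_def abs_divide divide_right_mono)
      qed
    qed (simp add: neg_quotient_nonneg)
  qed
  moreover have "neg_quotient p a e 0 = 0" by (simp add: neg_quotient_def)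
  ultimately show ?thesis
    by (simp add: tendsto_nhds_iff)
qed

section \<open>Lebesgue spaces: norm, Hoelder's inequality, vanishing perturbations\<close>

lemma Leb_norm_nonneg: "Leb_norm M s f \<ge> 0"
  by (simp add: Leb_norm_def)

lemma Leb_norm_powr:
  assumes "s > 0"
  shows "Leb_norm M s f powr s = (\<integral>x. \<bar>f x\<bar> powr s \<partial>M)"
  using assms by (simp add: Leb_norm_def powr_powr)

lemma Leb_norm_cmult:
  assumes "s > 0"
  shows "Leb_norm M s (\<lambda>x. c * f x) = \<bar>c\<bar> * Leb_norm M s f"
proof -
  have "(\<integral>x. \<bar>c * f x\<bar> powr s \<partial>M) = \<bar>c\<bar> powr s * (\<integral>x. \<bar>f x\<bar> powr s \<partial>M)"
    by (simp add: abs_mult powr_mult)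
  then show ?thesis using assms by (simp add: Leb_norm_def powr_mult powr_powr)
qed

lemma Leb_norm_eq_0_imp_AE:
  assumes "f \<in> Leb_space M s" "s > 0" "Leb_norm M s f = 0"
  shows "AE x in M. f x = 0"
proof -
  have "(\<integral>x. \<bar>f x\<bar> powr s \<partial>M) = 0"
    using Leb_norm_powr[OF assms(2), of M f] assms by simp
  then have "AE x in M. \<bar>f x\<bar> powr s = 0"
    using assms integral_nonneg_eq_0_iff_AE[of M "\<lambda>x. \<bar>f x\<bar> powr s"] by (simp add: Leb_space_def)
  then show ?thesis by eventually_elim auto
qed

text \<open>Young's inequality, integrated as it stands, gives integrability; integrated after both
  functions are normalised to norm 1, it gives the bound, since the right-hand side becomes
  \<open>1 / r + 1 / s\<close>. A function of norm 0 cannot be normalised, but then the product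
  vanishes almost everywhere.\<close>

lemma Leb_Holder:
  assumes f: "f \<in> Leb_space M r" and g: "g \<in> Leb_space M s"
    and rs: "1 < r" "1 < s" "1 / s + 1 / r = 1"
  shows "integrable M (\<lambda>x. f x * g x)"
    and "(\<integral>x. \<bar>f x * g x\<bar> \<partial>M) \<le> Leb_norm M r f * Leb_norm M s g"
proof -
  have meas[measurable]: "f \<in> borel_measurable M" "g \<in> borel_measurable M"
    using f g by (auto simp: Leb_space_def)
  have intf: "integrable M (\<lambda>x. \<bar>f x\<bar> powr r)" and intg: "integrable M (\<lambda>x. \<bar>g x\<bar> powr s)"
    using f g by (auto simp: Leb_space_def)
  have young: "\<bar>a * b\<bar> \<le> \<bar>a\<bar> powr r / r + \<bar>b\<bar> powr s / s" for a b :: real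
    using Youngs_inequality[of r s "\<bar>a\<bar>" "\<bar>b\<bar>"] rs by (simp add: abs_mult add.commute)
  show int: "integrable M (\<lambda>x. f x * g x)"
  proof (rule Bochner_Integration.integrable_bound)
    show "integrable M (\<lambda>x. \<bar>f x\<bar> powr r / r + \<bar>g x\<bar> powr s / s)" using intf intg by simp
    show "AE x in M. norm (f x * g x) \<le> norm (\<bar>f x\<bar> powr r / r + \<bar>g x\<bar> powr s / s)"
      using young rs by (intro AE_I2) (simp add: order_trans[OF young abs_ge_self])
  qed measurable
  show "(\<integral>x. \<bar>f x * g x\<bar> \<partial>M) \<le> Leb_norm M r f * Leb_norm M s g"
  proof (cases "Leb_norm M r f = 0 \<or> Leb_norm M s g = 0")
    case True
    then have "AE x in M. f x = 0 \<or> g x = 0"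
      using Leb_norm_eq_0_imp_AE[OF f] Leb_norm_eq_0_imp_AE[OF g] rs by auto
    then have "(\<integral>x. \<bar>f x * g x\<bar> \<partial>M) = (\<integral>x. 0 \<partial>M)"
      by (intro integral_cong_AE) (auto elim: eventually_mono)
    then show ?thesis by (simp add: Leb_norm_nonneg)
  next
    case False
    define A where "A = Leb_norm M r f"
    define B where "B = Leb_norm M s g"
    have AB: "A > 0" "B > 0"
      using False Leb_norm_nonneg[of M r f] Leb_norm_nonneg[of M s g] by (auto simp: A_def B_def)
    have A: "(\<integral>x. \<bar>f x\<bar> powr r \<partial>M) = A powr r" and B: "(\<integral>x. \<bar>g x\<bar> powr s \<partial>M) = B powr s"
      using rs by (auto simp: A_def B_def Leb_norm_powr)
    have "(\<integral>x. \<bar>f x * g x\<bar> \<partial>M) / (A * B) = (\<integral>x. \<bar>f x * g x\<bar> / (A * B) \<partial>M)" by simp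
    also have "\<dots> \<le> (\<integral>x. \<bar>f x\<bar> powr r / (r * A powr r) + \<bar>g x\<bar> powr s / (s * B powr s) \<partial>M)"
    proof (rule integral_mono)
      fix x
      show "\<bar>f x * g x\<bar> / (A * B) \<le> \<bar>f x\<bar> powr r / (r * A powr r) + \<bar>g x\<bar> powr s / (s * B powr s)"
        using young[of "f x / A" "g x / B"] AB
        by (simp add: abs_mult powr_divide mult.commute)
    qed (use int intf intg in auto)
    also have "\<dots> = 1 / r + 1 / s" using intf intg AB by (simp add: A B)
    finally show ?thesis using rs AB by (simp add: A_def B_def pos_divide_le_eq add.commute)
  qed
qed

text \<open>Makes the filter usable through explicit radii and sequences. \<open>filtercomap\<close>
  asks for a predicate on norms; the open interval from 0 to \<open>d\<close> is the one to
  take.\<close>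

lemma eventually_Leb_at_0:
  "eventually P (Leb_at_0 M s) \<longleftrightarrow>
     (\<exists>d>0. \<forall>h\<in>Leb_space M s. 0 < Leb_norm M s h \<and> Leb_norm M s h < d \<longrightarrow> P h)"
proof -
  have "eventually P (Leb_at_0 M s) \<longleftrightarrow>
      (\<exists>Q. (\<exists>d>0. \<forall>y>0. y < d \<longrightarrow> Q y) \<and> (\<forall>h. Q (Leb_norm M s h) \<longrightarrow> h \<in> Leb_space M s \<longrightarrow> P h))"
    unfolding Leb_at_0_def eventually_inf_principal eventually_filtercomap eventually_at_right_field
    by blast
  also have "\<dots> \<longleftrightarrow>
      (\<exists>d>0. \<forall>h\<in>Leb_space M s. 0 < Leb_norm M s h \<and> Leb_norm M s h < d \<longrightarrow> P h)"
  proof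
    assume "\<exists>d>0. \<forall>h\<in>Leb_space M s. 0 < Leb_norm M s h \<and> Leb_norm M s h < d \<longrightarrow> P h"
    then obtain d where "d > 0"
      "\<forall>h\<in>Leb_space M s. 0 < Leb_norm M s h \<and> Leb_norm M s h < d \<longrightarrow> P h" by blast
    then show "\<exists>Q. (\<exists>d>0. \<forall>y>0. y < d \<longrightarrow> Q y) \<and>
        (\<forall>h. Q (Leb_norm M s h) \<longrightarrow> h \<in> Leb_space M s \<longrightarrow> P h)"
      by (intro exI[of _ "\<lambda>y. 0 < y \<and> y < d"]) auto
  qed blast
  finally show ?thesis .
qed

lemma Leb_space_cmult:
  assumes "f \<in> Leb_space M s"
  shows "(\<lambda>x. c * f x) \<in> Leb_space M s"
  using assms by (auto simp: Leb_space_def abs_mult powr_mult)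

lemma Leb_space_minus:
  assumes "f \<in> Leb_space M s"
  shows "(\<lambda>x. - f x) \<in> Leb_space M s"
  using assms by (auto simp: Leb_space_def)

lemma Leb_space_add:
  assumes "f \<in> Leb_space M s" "g \<in> Leb_space M s" "s > 0"
  shows "(\<lambda>x. f x + g x) \<in> Leb_space M s"
proof -
  have [measurable]: "f \<in> borel_measurable M" "g \<in> borel_measurable M"
    and int: "integrable M (\<lambda>x. \<bar>f x\<bar> powr s)" "integrable M (\<lambda>x. \<bar>g x\<bar> powr s)"
    using assms by (auto simp: Leb_space_def)
  \<comment> \<open>The factor \<open>2 powr s\<close> comes from
    \<open>\<bar>a + b\<bar> \<le> 2 * max \<bar>a\<bar> \<bar>b\<bar>\<close>; only finiteness of
    the integral matters, so a crude constant is enough.\<close>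
  have "\<bar>a + b\<bar> powr s \<le> 2 powr s * (\<bar>a\<bar> powr s + \<bar>b\<bar> powr s)" for a b :: real
  proof -
    have "\<bar>a + b\<bar> powr s \<le> (2 * max \<bar>a\<bar> \<bar>b\<bar>) powr s" using assms by (intro powr_mono2) auto
    also have "\<dots> = 2 powr s * max \<bar>a\<bar> \<bar>b\<bar> powr s" by (simp add: powr_mult)
    also have "\<dots> \<le> 2 powr s * (\<bar>a\<bar> powr s + \<bar>b\<bar> powr s)"
      by (intro mult_left_mono) (auto simp: max_def)
    finally show ?thesis .
  qed
  then have "AE x in M. norm (\<bar>f x + g x\<bar> powr s) \<le> norm (2 powr s * (\<bar>f x\<bar> powr s + \<bar>g x\<bar> powr s))"
    by simp
  moreover have "integrable M (\<lambda>x. 2 powr s * (\<bar>f x\<bar> powr s + \<bar>g x\<bar> powr s))"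
    using int by simp
  ultimately have "integrable M (\<lambda>x. \<bar>f x + g x\<bar> powr s)"
    by (rule Bochner_Integration.integrable_bound[rotated 2]) measurable
  then show ?thesis by (simp add: Leb_space_def)
qed

section \<open>Finite measures: integrable powers and bounded test functions\<close>

context finite_measure
begin

lemma Leb_space_bounded:
  assumes [measurable]: "v \<in> borel_measurable M" and "\<And>x. \<bar>v x\<bar> \<le> 1" and "s > 0"
  shows "v \<in> Leb_space M s"
proof -
  have "integrable M (\<lambda>x. \<bar>v x\<bar> powr s)"
  proof (rule integrable_const_bound[where B = 1])
    show "AE x in M. norm (\<bar>v x\<bar> powr s) \<le> 1"
      using assms powr_mono2[of s _ 1] by (intro AE_I2) auto
  qed measurable
  then show ?thesis by (simp add: Leb_space_def)
qed

text \<open>Splitting at \<open>\<bar>a\<bar> = 1\<close> gives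
  \<open>\<bar>a\<bar> powr p \<le> 1 + \<bar>a\<bar> powr s\<close>, and constants are integrable.
  Hence the integral in \<open>q_fun\<close> is a genuine one on all of
  \<open>Leb_space M s\<close>.\<close>

lemma Leb_space_integrable_powr:
  assumes "f \<in> Leb_space M s" "0 < p" "p \<le> s"
  shows "integrable M (\<lambda>x. \<bar>f x\<bar> powr p)"
proof (rule Bochner_Integration.integrable_bound)
  have [measurable]: "f \<in> borel_measurable M" using assms by (auto simp: Leb_space_def)
  show "integrable M (\<lambda>x. 1 + \<bar>f x\<bar> powr s)" using assms by (auto simp: Leb_space_def)
  have "\<bar>a\<bar> powr p \<le> 1 + \<bar>a\<bar> powr s" for a :: real
  proof (cases "\<bar>a\<bar> \<le> 1")
    case True
    then have "\<bar>a\<bar> powr p \<le> 1" using assms powr_mono2[of p "\<bar>a\<bar>" 1] by simp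
    then show ?thesis by (smt (verit) powr_ge_zero)
  next
    case False
    then have "\<bar>a\<bar> powr p \<le> \<bar>a\<bar> powr s" using assms powr_mono[of p s "\<bar>a\<bar>"] by simp
    then show ?thesis by simp
  qed
  then show "AE x in M. norm (\<bar>f x\<bar> powr p) \<le> norm (1 + \<bar>f x\<bar> powr s)"
    by (intro AE_I2) (smt (verit) powr_ge_zero real_norm_def)
  show "(\<lambda>x. \<bar>f x\<bar> powr p) \<in> borel_measurable M" by measurable
qed

text \<open>Weak convergence will be tested against bounded functions only. These lie in
  \<open>Leb_space M s\<close>, so Hoelder's inequality bounds the functional with constant
  \<open>Leb_norm M s v\<close>.\<close>

lemma Leb_dual_integral:
  assumes v[measurable]: "v \<in> borel_measurable M" and "\<And>x. \<bar>v x\<bar> \<le> 1"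
    and rs: "1 < r" "1 < s" "1 / s + 1 / r = 1"
  shows "(\<lambda>f. \<integral>x. v x * f x \<partial>M) \<in> Leb_dual M r"
proof -
  have vs: "v \<in> Leb_space M s" using assms by (intro Leb_space_bounded) auto
  have int: "integrable M (\<lambda>x. v x * f x)" if "f \<in> Leb_space M r" for f
    using Leb_Holder(1)[OF that vs rs] by (simp add: mult.commute)
  have "\<bar>\<integral>x. v x * f x \<partial>M\<bar> \<le> Leb_norm M s v * Leb_norm M r f" if "f \<in> Leb_space M r" for f
  proof -
    have "\<bar>\<integral>x. v x * f x \<partial>M\<bar> \<le> (\<integral>x. \<bar>f x * v x\<bar> \<partial>M)"
      using integral_abs_bound[of M "\<lambda>x. v x * f x"] by (simp add: mult.commute)
    also have "\<dots> \<le> Leb_norm M r f * Leb_norm M s v" by (rule Leb_Holder(2)[OF that vs rs])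
    finally show ?thesis by (simp add: mult.commute)
  qed
  then show ?thesis
    using int by (auto simp: Leb_dual_def distrib_left mult.left_commute)
qed

section \<open>Frechet subdifferential of \<open>q_fun\<close>\<close>

lemma q_fun_diff_eq:
  assumes u: "u \<in> Leb_space M s" and h: "h \<in> Leb_space M s" and \<eta>: "\<eta> \<in> Leb_space M r"
    and p: "0 < p" "p < 1" and rs: "1 < r" "1 < s" "1 / s + 1 / r = 1"
  shows "integrable M (\<lambda>x. \<bar>u x + h x\<bar> powr p - \<bar>u x\<bar> powr p - \<eta> x * h x)"
    and "q_fun M p (\<lambda>x. u x + h x) - q_fun M p u - (\<integral>x. \<eta> x * h x \<partial>M)
      = (\<integral>x. \<bar>u x + h x\<bar> powr p - \<bar>u x\<bar> powr p - \<eta> x * h x \<partial>M)"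
proof -
  have int: "integrable M (\<lambda>x. \<bar>u x + h x\<bar> powr p)" "integrable M (\<lambda>x. \<bar>u x\<bar> powr p)"
      "integrable M (\<lambda>x. \<eta> x * h x)"
    using Leb_space_integrable_powr[OF u, of p] p rs Leb_Holder(1)[OF \<eta> h rs]
      Leb_space_integrable_powr[OF Leb_space_add[OF u h], of p] by auto
  then show "integrable M (\<lambda>x. \<bar>u x + h x\<bar> powr p - \<bar>u x\<bar> powr p - \<eta> x * h x)" by simp
  show "q_fun M p (\<lambda>x. u x + h x) - q_fun M p u - (\<integral>x. \<eta> x * h x \<partial>M)
      = (\<integral>x. \<bar>u x + h x\<bar> powr p - \<bar>u x\<bar> powr p - \<eta> x * h x \<partial>M)"
    using int by (simp add: q_fun_def)
qed

lemma frechet_subdiff_q_funI: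
  assumes u: "u \<in> Leb_space M s" and \<eta>: "\<eta> \<in> Leb_space M r"
    and p: "0 < p" "p < 1" and rs: "1 < r" "1 < s" "1 / s + 1 / r = 1"
    and ae: "AE x in M. u x \<noteq> 0 \<longrightarrow> \<eta> x = p * \<bar>u x\<bar> powr (p - 2) * u x"
  shows "\<eta> \<in> frechet_subdiff M s r (q_fun M p) u"
proof -
  define Q where
    "Q h = (q_fun M p (\<lambda>x. u x + h x) - q_fun M p u - (\<integral>x. \<eta> x * h x \<partial>M)) / Leb_norm M s h" for h
  have [measurable]: "u \<in> borel_measurable M" "\<eta> \<in> borel_measurable M"
    using u \<eta> by (auto simp: Leb_space_def)
  have "eventually (\<lambda>h. y < ereal (Q h)) (Leb_at_0 M s)" if "y < 0" for y
  proof (rule ccontr)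
    \<comment> \<open>Failure at level \<open>y\<close> produces perturbations of positive norm
      below \<open>1 / Suc k\<close> whose quotients never exceed \<open>y\<close>.\<close>
    assume "\<not> ?thesis"
    then have "\<exists>h\<in>Leb_space M s. 0 < Leb_norm M s h \<and> Leb_norm M s h < 1 / Suc k
        \<and> \<not> y < ereal (Q h)" for k
      unfolding eventually_Leb_at_0 not_ex not_all
      by (auto dest!: spec[of _ "1 / Suc k"])
    then obtain h where h: "\<And>k. h k \<in> Leb_space M s" "\<And>k. 0 < Leb_norm M s (h k)"
      "\<And>k. Leb_norm M s (h k) < 1 / Suc k" "\<And>k. ereal (Q (h k)) \<le> y"
      by (metis not_less)
    have [measurable]: "h k \<in> borel_measurable M" for k using h(1)[of k] by (simp add: Leb_space_def)
    have "(\<lambda>k. Leb_norm M s (h k)) \<longlonglongrightarrow> 0"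
      by (rule tendsto_sandwich[OF _ _ tendsto_const LIMSEQ_inverse_real_of_nat])
        (use h in \<open>auto simp: less_imp_le inverse_eq_divide\<close>)
    then have "(\<lambda>k. Leb_norm M s (h k) powr s) \<longlonglongrightarrow> 0 powr s"
      using rs h(2) by (intro tendsto_powr') (auto simp: less_imp_le)
    then have "(\<lambda>k. \<integral>x. norm (\<bar>h k x\<bar> powr s) \<partial>M) \<longlonglongrightarrow> 0"
      using rs by (simp add: Leb_norm_powr)
    \<comment> \<open>The powers \<open>\<bar>h k x\<bar> powr s\<close> tend to 0 in L^1, which
      gives an almost everywhere convergent subsequence; taking roots pointwise then removes the
      exponent.\<close>
    then obtain \<sigma> where "AE x in M. (\<lambda>k. \<bar>h (\<sigma> k) x\<bar> powr s) \<longlonglongrightarrow> 0"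
      using tendsto_L1_AE_subseq[of M "\<lambda>k x. \<bar>h k x\<bar> powr s"] h(1)
      by (auto simp: Leb_space_def)
    then have h0: "AE x in M. (\<lambda>k. h (\<sigma> k) x) \<longlonglongrightarrow> 0"
    proof eventually_elim
      case (elim x)
      have "(\<lambda>k. (\<bar>h (\<sigma> k) x\<bar> powr s) powr (1 / s)) \<longlonglongrightarrow> 0 powr (1 / s)"
        using elim rs by (intro tendsto_powr') auto
      then show ?case using rs by (simp add: powr_powr tendsto_rabs_zero_iff)
    qed
    \<comment> \<open>Dominated by a multiple of \<open>\<bar>\<eta>\<bar>\<close> and tending to 0
      almost everywhere, \<open>w k\<close> tends to 0 in L^r.\<close>
    define w where "w k x = neg_quotient p (u x) (\<eta> x) (h (\<sigma> k) x)" for k x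
    have [measurable]: "w k \<in> borel_measurable M" for k
      unfolding w_def neg_quotient_def by measurable
    have w_le: "AE x in M. \<bar>w k x\<bar> \<le> \<bar>(1 + 1 / p) * \<eta> x\<bar>" for k
      using ae
    proof eventually_elim
      case (elim x)
      then show ?case
        using neg_quotient_le[OF p elim, of "h (\<sigma> k) x"] neg_quotient_nonneg p
        by (simp add: w_def abs_mult)
    qed
    have dom: "integrable M (\<lambda>x. \<bar>(1 + 1 / p) * \<eta> x\<bar> powr r)"
      using Leb_space_cmult[OF \<eta>, of "1 + 1 / p"] unfolding Leb_space_def by blast
    have w_le': "AE x in M. norm (\<bar>w k x\<bar> powr r) \<le> \<bar>(1 + 1 / p) * \<eta> x\<bar> powr r" for k
      using w_le[of k] by eventually_elim (use rs in \<open>auto intro!: powr_mono2\<close>)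
    have w_space: "w k \<in> Leb_space M r" for k
      using Bochner_Integration.integrable_bound[OF dom, of "\<lambda>x. \<bar>w k x\<bar> powr r"] w_le'[of k]
      by (auto simp: Leb_space_def)
    have "AE x in M. (\<lambda>k. \<bar>w k x\<bar> powr r) \<longlonglongrightarrow> 0"
      using ae h0
    proof eventually_elim
      case (elim x)
      have "(\<lambda>k. w k x) \<longlonglongrightarrow> 0"
        unfolding w_def by (rule filterlim_compose[OF tendsto_neg_quotient[OF p elim(1)] elim(2)])
      then have "(\<lambda>k. \<bar>w k x\<bar>) \<longlonglongrightarrow> 0" by (simp add: tendsto_rabs_zero_iff)
      then have "(\<lambda>k. \<bar>w k x\<bar> powr r) \<longlonglongrightarrow> 0 powr r"
        using rs by (intro tendsto_powr') auto
      then show ?case by simp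
    qed
    then have "(\<lambda>k. \<integral>x. \<bar>w k x\<bar> powr r \<partial>M) \<longlonglongrightarrow> (\<integral>x. 0 \<partial>M)"
      by (intro integral_dominated_convergence[OF _ _ dom _ w_le']) auto
    then have "(\<lambda>k. (\<integral>x. \<bar>w k x\<bar> powr r \<partial>M) powr (1 / r)) \<longlonglongrightarrow> 0 powr (1 / r)"
      using rs by (intro tendsto_powr') auto
    then have "(\<lambda>k. ereal (- Leb_norm M r (w k))) \<longlonglongrightarrow> ereal (- 0)"
      unfolding Leb_norm_def by (intro tendsto_intros) simp
    \<comment> \<open>The defect at \<open>g\<close> is at least
      \<open>- \<bar>w k x * g x\<bar>\<close> pointwise, so by Hoelder's inequality the quotient
      \<open>Q g\<close> is at least \<open>- Leb_norm M r (w k)\<close>. These bounds tend to 0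
      while staying below \<open>y\<close>, which excludes \<open>y < 0\<close>.\<close>
    moreover have "ereal (- Leb_norm M r (w k)) \<le> y" for k
    proof -
      define g where "g = h (\<sigma> k)"
      have g: "g \<in> Leb_space M s" "Leb_norm M s g > 0" "ereal (Q g) \<le> y"
        using h by (auto simp: g_def)
      have "- (Leb_norm M r (w k) * Leb_norm M s g) \<le> - (\<integral>x. \<bar>w k x * g x\<bar> \<partial>M)"
        using Leb_Holder(2)[OF w_space g(1) rs] by simp
      also have "\<dots> = (\<integral>x. - \<bar>w k x * g x\<bar> \<partial>M)" by simp
      also have "\<dots> \<le> (\<integral>x. \<bar>u x + g x\<bar> powr p - \<bar>u x\<bar> powr p - \<eta> x * g x \<partial>M)"
      proof (rule integral_mono)
        show "integrable M (\<lambda>x. - \<bar>w k x * g x\<bar>)"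
          using Leb_Holder(1)[OF w_space g(1) rs] by simp
        show "integrable M (\<lambda>x. \<bar>u x + g x\<bar> powr p - \<bar>u x\<bar> powr p - \<eta> x * g x)"
          by (rule q_fun_diff_eq(1)[OF u g(1) \<eta> p rs])
        show "- \<bar>w k x * g x\<bar> \<le> \<bar>u x + g x\<bar> powr p - \<bar>u x\<bar> powr p - \<eta> x * g x" for x
          using neg_quotient_ge[of p "u x" "\<eta> x" "g x"]
          by (simp add: w_def g_def abs_mult neg_quotient_nonneg)
      qed
      also have "\<dots> = Q g * Leb_norm M s g"
        using g(2) by (simp add: Q_def q_fun_diff_eq(2)[OF u g(1) \<eta> p rs])
      finally have "- Leb_norm M r (w k) * Leb_norm M s g \<le> Q g * Leb_norm M s g" by simp
      then have "- Leb_norm M r (w k) \<le> Q g" using g(2) by (rule mult_right_le_imp_le)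
      then show ?thesis using g(3) by (meson ereal_less_eq(3) order_trans)
    qed
    ultimately have "ereal (- 0) \<le> y" by (meson LIMSEQ_le_const2)
    then show False using \<open>y < 0\<close> by (simp flip: zero_ereal_def)
  qed
  then show ?thesis using \<eta> by (simp add: frechet_subdiff_def le_Liminf_iff Q_def)
qed

text \<open>The derivative of the power is unbounded near 0; confining \<open>v\<close> to points
  with \<open>c \<le> \<bar>u x\<bar>\<close> bounds all difference quotients by
  \<open>c powr (p - 1)\<close>, and dominated convergence applies.\<close>

lemma tendsto_q_fun_directional:
  assumes u: "u \<in> Leb_space M s" and v: "v \<in> Leb_space M s" and s: "1 < s"
    and p: "0 < p" "p < 1"
    and c: "c > 0" "\<And>x. v x \<noteq> 0 \<Longrightarrow> c \<le> \<bar>u x\<bar>" and v1: "\<And>x. \<bar>v x\<bar> \<le> 1"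
    and t: "t \<longlonglongrightarrow> 0" "\<And>k. t k > 0"
  shows "(\<lambda>k. (q_fun M p (\<lambda>x. u x + t k * v x) - q_fun M p u) / t k)
      \<longlonglongrightarrow> (\<integral>x. p * \<bar>u x\<bar> powr (p - 2) * u x * v x \<partial>M)"
proof -
  have [measurable]: "u \<in> borel_measurable M" "v \<in> borel_measurable M"
    using u v by (auto simp: Leb_space_def)
  have eq: "(q_fun M p (\<lambda>x. u x + t k * v x) - q_fun M p u) / t k
      = (\<integral>x. (\<bar>u x + t k * v x\<bar> powr p - \<bar>u x\<bar> powr p) / t k \<partial>M)" for k
    using Leb_space_integrable_powr[OF u, of p] p s
      Leb_space_integrable_powr[OF Leb_space_add[OF u Leb_space_cmult[OF v, of "t k"]], of p]
    by (simp add: q_fun_def)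
  show ?thesis unfolding eq
  proof (rule integral_dominated_convergence[where w = "\<lambda>_. c powr (p - 1)"])
    show "AE x in M. (\<lambda>k. (\<bar>u x + t k * v x\<bar> powr p - \<bar>u x\<bar> powr p) / t k)
        \<longlonglongrightarrow> p * \<bar>u x\<bar> powr (p - 2) * u x * v x"
    proof (rule AE_I2)
      fix x
      show "(\<lambda>k. (\<bar>u x + t k * v x\<bar> powr p - \<bar>u x\<bar> powr p) / t k)
        \<longlonglongrightarrow> p * \<bar>u x\<bar> powr (p - 2) * u x * v x"
      proof (cases "v x = 0")
        case False
        then have u0: "u x \<noteq> 0" using c by force
        have "((\<lambda>h. (\<bar>u x + h\<bar> powr p - \<bar>u x\<bar> powr p) / h) \<longlongrightarrow> p * \<bar>u x\<bar> powr (p - 2) * u x) (at 0)"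
          using has_real_derivative_abs_powr[OF u0, of p] unfolding DERIV_def .
        moreover have "filterlim (\<lambda>k. t k * v x) (at 0) sequentially"
          using False t(2) tendsto_mult_right[OF t(1), of "v x"]
          by (auto simp: filterlim_at less_imp_neq[symmetric])
        ultimately have "(\<lambda>k. (\<bar>u x + t k * v x\<bar> powr p - \<bar>u x\<bar> powr p) / (t k * v x))
          \<longlonglongrightarrow> p * \<bar>u x\<bar> powr (p - 2) * u x" by (rule filterlim_compose)
        from tendsto_mult_right[OF this, of "v x"] show ?thesis using False by simp
      qed simp
    qed
    show "AE x in M. norm ((\<bar>u x + t k * v x\<bar> powr p - \<bar>u x\<bar> powr p) / t k) \<le> c powr (p - 1)" for k
    proof (rule AE_I2)
      fix x
      show "norm ((\<bar>u x + t k * v x\<bar> powr p - \<bar>u x\<bar> powr p) / t k) \<le> c powr (p - 1)"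
      proof (cases "v x = 0")
        case False
        then have cu: "c \<le> \<bar>u x\<bar>" and u0: "u x \<noteq> 0" using c by force+
        have "\<bar>\<bar>u x + t k * v x\<bar> powr p - \<bar>u x\<bar> powr p\<bar> \<le> \<bar>u x\<bar> powr (p - 1) * \<bar>t k * v x\<bar>"
          by (rule abs_powr_diff_bound[OF p u0])
        also have "\<dots> \<le> c powr (p - 1) * (t k * 1)"
          using cu c(1) p t(2)[of k] v1[of x] mult_left_le[of "\<bar>v x\<bar>" "t k"]
          by (intro mult_mono powr_mono2') (auto simp: abs_mult)
        finally show ?thesis using t(2)[of k] by (simp add: abs_divide pos_divide_le_eq)
      qed simp
    qed
  qed auto
qed

lemma frechet_subdiff_q_funD:
  assumes u: "u \<in> Leb_space M s" and sub: "\<eta> \<in> frechet_subdiff M s r (q_fun M p) u"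
    and p: "0 < p" "p < 1" and rs: "1 < r" "1 < s" "1 / s + 1 / r = 1"
  shows "AE x in M. u x \<noteq> 0 \<longrightarrow> \<eta> x = p * \<bar>u x\<bar> powr (p - 2) * u x"
proof -
  define g where "g x = p * \<bar>u x\<bar> powr (p - 2) * u x" for x
  have \<eta>: "\<eta> \<in> Leb_space M r" using sub by (simp add: frechet_subdiff_def)
  have [measurable]: "u \<in> borel_measurable M" "\<eta> \<in> borel_measurable M" "g \<in> borel_measurable M"
    using u \<eta> unfolding g_def[abs_def] by (auto simp: Leb_space_def)
  have "AE x in M. 1 / Suc n \<le> \<bar>u x\<bar> \<longrightarrow> \<eta> x = g x" for n
  proof -
    \<comment> \<open>The sign makes \<open>(\<eta> x - g x) * v x\<close> equal to
      \<open>\<bar>\<eta> x - g x\<bar>\<close> on the truncated set, so a one-sided inequality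
      between the integrals will suffice.\<close>
    define v where "v x = (if 1 / Suc n \<le> \<bar>u x\<bar> then sgn (\<eta> x - g x) else 0)" for x
    have [measurable]: "v \<in> borel_measurable M" unfolding v_def[abs_def] by measurable
    have v1: "\<bar>v x\<bar> \<le> 1" for x by (simp add: v_def sgn_real_def)
    have v: "v \<in> Leb_space M s" using v1 rs by (intro Leb_space_bounded) auto
    show ?thesis
    \<comment> \<open>\<open>Leb_at_0\<close> sees only positive norms. If \<open>v\<close> has norm
      0, the sign vanishes almost everywhere, which already is the claim.\<close>
    proof (cases "Leb_norm M s v = 0")
      case True
      then have "AE x in M. v x = 0" using Leb_norm_eq_0_imp_AE[OF v] rs by simp
      then show ?thesis by eventually_elim (auto simp: v_def sgn_eq_0_iff)
    next
      case False
      then have v0: "Leb_norm M s v > 0" using Leb_norm_nonneg[of M s v] by simp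
      define t where "t k = inverse (real (Suc k))" for k
      have t: "t \<longlonglongrightarrow> 0" "t k > 0" for k
        using LIMSEQ_inverse_real_of_nat by (auto simp: t_def[abs_def])
      define D where "D k = (q_fun M p (\<lambda>x. u x + t k * v x) - q_fun M p u) / t k" for k
      have D: "D \<longlonglongrightarrow> (\<integral>x. g x * v x \<partial>M)"
        unfolding D_def g_def
        by (rule tendsto_q_fun_directional[OF u v rs(2) p, of "1 / Suc n"])
          (use v1 t in \<open>auto simp: v_def split: if_splits\<close>)
      \<comment> \<open>The subgradient inequality at a level \<open>c < 0\<close> along the ray
        \<open>t k * v\<close>, divided by \<open>t k\<close>; the norm of \<open>v\<close> survives
        as a factor.\<close>
      have ev: "eventually (\<lambda>k. c * Leb_norm M s v \<le> D k - (\<integral>x. \<eta> x * v x \<partial>M)) sequentially"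
        if "c < 0" for c
      proof -
        have "eventually (\<lambda>h. ereal c < ereal ((q_fun M p (\<lambda>x. u x + h x) - q_fun M p u
            - (\<integral>x. \<eta> x * h x \<partial>M)) / Leb_norm M s h)) (Leb_at_0 M s)"
          using sub that unfolding frechet_subdiff_def le_Liminf_iff
          by (simp del: less_ereal.simps)
        then obtain d where d: "d > 0" "\<And>h. h \<in> Leb_space M s \<Longrightarrow> 0 < Leb_norm M s h \<Longrightarrow>
            Leb_norm M s h < d \<Longrightarrow> c < (q_fun M p (\<lambda>x. u x + h x) - q_fun M p u
            - (\<integral>x. \<eta> x * h x \<partial>M)) / Leb_norm M s h"
          unfolding eventually_Leb_at_0 by auto
        have "(\<lambda>k. t k * Leb_norm M s v) \<longlonglongrightarrow> 0 * Leb_norm M s v"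
          by (intro tendsto_intros t)
        then have "eventually (\<lambda>k. t k * Leb_norm M s v < d) sequentially"
          using d(1) by (intro order_tendstoD(2)) auto
        then show ?thesis
        proof eventually_elim
          case (elim k)
          have nrm: "Leb_norm M s (\<lambda>x. t k * v x) = t k * Leb_norm M s v"
            using Leb_norm_cmult[of s M "t k" v] rs t(2)[of k] by simp
          have "c < (q_fun M p (\<lambda>x. u x + t k * v x) - q_fun M p u
            - (\<integral>x. \<eta> x * (t k * v x) \<partial>M)) / (t k * Leb_norm M s v)"
            using d(2)[OF Leb_space_cmult[OF v, of "t k"]] elim t(2)[of k] v0 by (simp add: nrm)
          also have "(\<integral>x. \<eta> x * (t k * v x) \<partial>M) = t k * (\<integral>x. \<eta> x * v x \<partial>M)"
            by (simp add: mult.left_commute[of _ "t k"])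
          finally show ?case
            using t(2)[of k] v0 by (simp add: D_def field_simps)
        qed
      qed
      have lim: "c * Leb_norm M s v \<le> (\<integral>x. g x * v x \<partial>M) - (\<integral>x. \<eta> x * v x \<partial>M)" if "c < 0" for c
        by (rule tendsto_lowerbound[OF tendsto_diff[OF D tendsto_const] ev[OF that]]) simp
      \<comment> \<open>If the right side minus the left side were negative, the level
        \<open>c\<close> for which \<open>c * Leb_norm M s v\<close> is half that difference would
        contradict \<open>lim\<close>.\<close>
      have le: "(\<integral>x. \<eta> x * v x \<partial>M) \<le> (\<integral>x. g x * v x \<partial>M)"
      proof (rule ccontr)
        assume "\<not> ?thesis"
        then show False
          using lim[of "((\<integral>x. g x * v x \<partial>M) - (\<integral>x. \<eta> x * v x \<partial>M)) / (2 * Leb_norm M s v)"] v0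
          by (simp add: field_simps)
      qed
      have int\<eta>: "integrable M (\<lambda>x. \<eta> x * v x)" by (rule Leb_Holder(1)[OF \<eta> v rs])
      \<comment> \<open>Since \<open>p - 1 < 0\<close>, the bound
        \<open>1 / Suc n \<le> \<bar>u x\<bar>\<close> caps \<open>\<bar>g x\<bar>\<close> on the
        support of \<open>v\<close>.\<close>
      have intg: "integrable M (\<lambda>x. g x * v x)"
      proof (rule integrable_const_bound[where B = "p * (1 / Suc n) powr (p - 1)"])
        show "AE x in M. norm (g x * v x) \<le> p * (1 / Suc n) powr (p - 1)"
        proof (rule AE_I2)
          fix x
          show "norm (g x * v x) \<le> p * (1 / Suc n) powr (p - 1)"
          proof (cases "1 / Suc n \<le> \<bar>u x\<bar>")
            case True
            have "norm (g x * v x) = \<bar>g x\<bar> * \<bar>v x\<bar>" by (simp add: abs_mult)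
            also have "\<dots> \<le> \<bar>g x\<bar>" using v1[of x] by (simp add: mult_left_le)
            also have "\<dots> = p * \<bar>u x\<bar> powr (p - 1)"
              using p powr_add[of "\<bar>u x\<bar>" "p - 2" 1] by (simp add: g_def abs_mult)
            also have "\<dots> \<le> p * (1 / Suc n) powr (p - 1)"
              using p True by (intro mult_left_mono powr_mono2') auto
            finally show ?thesis .
          qed (use p in \<open>simp add: v_def\<close>)
        qed
      qed measurable
      have "(\<integral>x. (\<eta> x - g x) * v x \<partial>M) \<le> 0" using le int\<eta> intg by (simp add: left_diff_distrib)
      moreover have nn: "(\<eta> x - g x) * v x \<ge> 0" for x
        by (simp add: v_def sgn_real_def)
      ultimately have "(\<integral>x. (\<eta> x - g x) * v x \<partial>M) = 0"
        using Bochner_Integration.integral_nonneg[of M "\<lambda>x. (\<eta> x - g x) * v x"] by (intro antisym) auto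
      then have "AE x in M. (\<eta> x - g x) * v x = 0"
        using integral_nonneg_eq_0_iff_AE[of M "\<lambda>x. (\<eta> x - g x) * v x"] nn int\<eta> intg
        by (simp add: left_diff_distrib)
      then show ?thesis by eventually_elim (auto simp: v_def sgn_eq_0_iff)
    qed
  qed
  then have "AE x in M. \<forall>n. 1 / Suc n \<le> \<bar>u x\<bar> \<longrightarrow> \<eta> x = g x" unfolding AE_all_countable by blast
  then show ?thesis
  proof eventually_elim
    case (elim x)
    show ?case
    proof
      assume "u x \<noteq> 0"
      then obtain n where "inverse (real (Suc n)) < \<bar>u x\<bar>" using reals_Archimedean[of "\<bar>u x\<bar>"] by auto
      then have "1 / Suc n \<le> \<bar>u x\<bar>" by (simp add: inverse_eq_divide)
      then have "\<eta> x = g x" using elim by blast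
      then show "\<eta> x = p * \<bar>u x\<bar> powr (p - 2) * u x" by (simp add: g_def)
    qed
  qed
qed

section \<open>Limiting subdifferential of \<open>q_fun\<close>\<close>

lemma limiting_subdiff_q_funD:
  assumes u: "u \<in> Leb_space M s" and sub: "\<eta> \<in> limiting_subdiff M s r (q_fun M p) u"
    and p: "0 < p" "p < 1" and rs: "1 < r" "1 < s" "1 / s + 1 / r = 1"
  shows "AE x in M. u x \<noteq> 0 \<longrightarrow> \<eta> x = p * \<bar>u x\<bar> powr (p - 2) * u x"
proof -
  define g where "g y = p * \<bar>y\<bar> powr (p - 2) * y" for y
  have \<eta>: "\<eta> \<in> Leb_space M r" using sub by (simp add: limiting_subdiff_def)
  obtain U' H' where U': "\<And>k. U' k \<in> Leb_space M s" and H': "\<And>k. H' k \<in> Leb_space M r"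
    and conv: "Leb_converges M s U' u" and weak: "Leb_converges_weakly M r H' \<eta>"
    and fr: "\<And>k. H' k \<in> frechet_subdiff M s r (q_fun M p) (U' k)"
    using sub by (auto simp: limiting_subdiff_def)
  have diff: "(\<lambda>x. U' k x - u x) \<in> Leb_space M s" for k
    using Leb_space_add[OF U' Leb_space_minus[OF u], of k] rs by simp
  have "(\<lambda>k. Leb_norm M s (\<lambda>x. U' k x - u x) powr s) \<longlonglongrightarrow> 0 powr s"
    using conv rs unfolding Leb_converges_def
    by (intro tendsto_powr') (auto simp: Leb_norm_nonneg)
  then have "(\<lambda>k. \<integral>x. norm (\<bar>U' k x - u x\<bar> powr s) \<partial>M) \<longlonglongrightarrow> 0"
    using rs by (simp add: Leb_norm_powr)
  \<comment> \<open>Strict monotonicity is kept so that the integrals from weak convergence can be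
    followed along the same subsequence.\<close>
  then obtain \<sigma> :: "nat \<Rightarrow> nat" where \<sigma>: "strict_mono \<sigma>"
      "AE x in M. (\<lambda>k. \<bar>U' (\<sigma> k) x - u x\<bar> powr s) \<longlonglongrightarrow> 0"
    using tendsto_L1_AE_subseq[of M "\<lambda>k x. \<bar>U' k x - u x\<bar> powr s"] diff
    by (auto simp: Leb_space_def)
  define U where "U k = U' (\<sigma> k)" for k
  define H where "H k = H' (\<sigma> k)" for k
  have [measurable]: "u \<in> borel_measurable M" "\<eta> \<in> borel_measurable M"
      "U k \<in> borel_measurable M" "H k \<in> borel_measurable M" for k
    using u \<eta> U' H' by (auto simp: Leb_space_def U_def H_def)
  have [measurable]: "g \<in> borel_measurable borel" unfolding g_def[abs_def] by measurable
  have lim: "AE x in M. (\<lambda>k. U k x) \<longlonglongrightarrow> u x"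
    using \<sigma>(2)
  proof eventually_elim
    case (elim x)
    have "(\<lambda>k. (\<bar>U k x - u x\<bar> powr s) powr (1 / s)) \<longlonglongrightarrow> 0 powr (1 / s)"
      using elim rs unfolding U_def by (intro tendsto_powr') auto
    then have "(\<lambda>k. U k x - u x) \<longlonglongrightarrow> 0" using rs by (simp add: powr_powr tendsto_rabs_zero_iff)
    then show ?case by (simp add: LIM_zero_iff)
  qed
  have HU: "AE x in M. \<forall>k. U k x \<noteq> 0 \<longrightarrow> H k x = g (U k x)"
    unfolding AE_all_countable g_def U_def H_def
    using frechet_subdiff_q_funD[OF U' fr p rs] by blast
  have g_lim: "(\<lambda>k. g (U k x)) \<longlonglongrightarrow> g (u x)" if "(\<lambda>k. U k x) \<longlonglongrightarrow> u x" "u x \<noteq> 0" for x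
    unfolding g_def using that by (intro tendsto_intros) auto
  \<comment> \<open>One index \<open>N\<close> controls both how late \<open>k\<close> is and how
    far \<open>U k x\<close> stays from 0, so countably many sets are enough.\<close>
  define B where "B N = {x. \<forall>k\<ge>N. inverse (real (Suc N)) \<le> \<bar>U k x\<bar>}" for N
  have B_u: "inverse (real (Suc N)) \<le> \<bar>u x\<bar>" if "(\<lambda>k. U k x) \<longlonglongrightarrow> u x" "x \<in> B N" for x N
    using that by (intro LIMSEQ_le_const[OF tendsto_rabs[OF that(1)]]) (auto simp: B_def)
  have g_le: "\<bar>g y\<bar> \<le> p * inverse (real (Suc N)) powr (p - 1)"
    if "inverse (real (Suc N)) \<le> \<bar>y\<bar>" for y N
  proof -
    have "\<bar>g y\<bar> = p * \<bar>y\<bar> powr (p - 1)"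
      using p powr_add[of "\<bar>y\<bar>" "p - 2" 1] by (simp add: g_def abs_mult)
    also have "\<dots> \<le> p * inverse (real (Suc N)) powr (p - 1)"
      using p that by (intro mult_left_mono powr_mono2') auto
    finally show ?thesis .
  qed
  have "AE x in M. x \<in> B N \<longrightarrow> \<eta> x = g (u x)" for N
  proof -
    define C where "C = p * inverse (real (Suc N)) powr (p - 1)"
    \<comment> \<open>Again a sign, so that the integral of
      \<open>(\<eta> x - g (u x)) * v x\<close> is that of
      \<open>\<bar>\<eta> x - g (u x)\<bar>\<close> over \<open>B N\<close>.\<close>
    define v where "v x = (if x \<in> B N then sgn (\<eta> x - g (u x)) else 0)" for x
    have [measurable]: "v \<in> borel_measurable M" unfolding v_def[abs_def] B_def by measurable
    have v1: "\<bar>v x\<bar> \<le> 1" for x by (simp add: v_def sgn_real_def)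
    have vs: "v \<in> Leb_space M s" using v1 rs by (intro Leb_space_bounded) auto
    have "(\<lambda>k. \<integral>x. v x * H' k x \<partial>M) \<longlonglongrightarrow> (\<integral>x. v x * \<eta> x \<partial>M)"
      using weak Leb_dual_integral[of v, OF _ v1 rs] unfolding Leb_converges_weakly_def by auto
    \<comment> \<open>The shift by \<open>N\<close> drops the early terms, about which
      \<open>B N\<close> says nothing.\<close>
    then have lim1: "(\<lambda>k. \<integral>x. v x * H (k + N) x \<partial>M) \<longlonglongrightarrow> (\<integral>x. v x * \<eta> x \<partial>M)"
      using LIMSEQ_ignore_initial_segment[OF LIMSEQ_subseq_LIMSEQ[OF _ \<sigma>(1)]]
      unfolding H_def o_def by fast
    \<comment> \<open>On \<open>B N\<close> the lower bound passes to the limit \<open>u x\<close>,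
      which is therefore nonzero, and \<open>g\<close> is continuous there.\<close>
    have gv_lim: "AE x in M. (\<lambda>k. v x * H (k + N) x) \<longlonglongrightarrow> v x * g (u x)"
      using lim HU
    proof eventually_elim
      case (elim x)
      show ?case
      proof (cases "x \<in> B N")
        case True
        then have u0: "u x \<noteq> 0" using B_u[OF elim(1), of N] by auto
        have "U (k + N) x \<noteq> 0" for k using True by (auto simp: B_def dest!: spec[of _ "k + N"])
        then have "H (k + N) x = g (U (k + N) x)" for k using elim(2) by blast
        then show ?thesis
          using LIMSEQ_ignore_initial_segment[OF g_lim[OF elim(1) u0], of N]
          by (intro tendsto_intros) simp
      qed (simp add: v_def)
    qed
    have Hv_le: "AE x in M. norm (v x * H (k + N) x) \<le> C" for k
      using HU
    proof eventually_elim
      case (elim x)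
      show ?case
      proof (cases "x \<in> B N")
        case True
        then have ge: "inverse (real (Suc N)) \<le> \<bar>U (k + N) x\<bar>" by (simp add: B_def)
        then have "U (k + N) x \<noteq> 0" by auto
        then have "\<bar>H (k + N) x\<bar> \<le> C" using elim g_le[OF ge] by (simp add: C_def)
        then have "\<bar>v x\<bar> * \<bar>H (k + N) x\<bar> \<le> 1 * C" using v1[of x] by (intro mult_mono) auto
        then show ?thesis by (simp add: abs_mult)
      qed (use p in \<open>simp add: v_def C_def\<close>)
    qed
    have "(\<lambda>k. \<integral>x. v x * H (k + N) x \<partial>M) \<longlonglongrightarrow> (\<integral>x. v x * g (u x) \<partial>M)"
      by (rule integral_dominated_convergence[OF _ _ _ gv_lim Hv_le]) auto
    then have eq: "(\<integral>x. v x * \<eta> x \<partial>M) = (\<integral>x. v x * g (u x) \<partial>M)"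
      using lim1 LIMSEQ_unique by blast
    have int: "integrable M (\<lambda>x. v x * \<eta> x)"
      using Leb_Holder(1)[OF \<eta> vs rs] by (simp add: mult.commute)
    have "integrable M (\<lambda>x. v x * g (u x))"
      by (rule integrable_dominated_convergence[OF _ _ _ gv_lim Hv_le]) auto
    with int eq have int0: "integrable M (\<lambda>x. (\<eta> x - g (u x)) * v x)"
      "(\<integral>x. (\<eta> x - g (u x)) * v x \<partial>M) = 0"
      by (simp_all add: right_diff_distrib mult.commute[of _ "v _"])
    moreover have "(\<eta> x - g (u x)) * v x \<ge> 0" for x by (simp add: v_def sgn_real_def)
    ultimately have "AE x in M. (\<eta> x - g (u x)) * v x = 0"
      using integral_nonneg_eq_0_iff_AE[of M "\<lambda>x. (\<eta> x - g (u x)) * v x"] by simp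
    then show ?thesis by eventually_elim (auto simp: v_def sgn_eq_0_iff)
  qed
  then have "AE x in M. \<forall>N. x \<in> B N \<longrightarrow> \<eta> x = g (u x)" unfolding AE_all_countable by blast
  then show ?thesis
    using lim
  proof eventually_elim
    case (elim x)
    show ?case
    proof
      assume u0: "u x \<noteq> 0"
      \<comment> \<open>The value \<open>\<bar>u x\<bar> / 2\<close> eventually separates
        \<open>\<bar>U k x\<bar>\<close> from \<open>inverse (real (Suc k))\<close>; any
        \<open>N\<close> from which this holds puts \<open>x\<close> into
        \<open>B N\<close>.\<close>
      have half: "\<bar>u x\<bar> / 2 < \<bar>u x\<bar>" "0 < \<bar>u x\<bar> / 2" using u0 by auto
      have "eventually (\<lambda>k. \<bar>u x\<bar> / 2 < \<bar>U k x\<bar>) sequentially"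
        by (rule order_tendstoD(1)[OF tendsto_rabs[OF elim(2)] half(1)])
      moreover have "eventually (\<lambda>k. inverse (real (Suc k)) < \<bar>u x\<bar> / 2) sequentially"
        by (rule order_tendstoD(2)[OF LIMSEQ_inverse_real_of_nat half(2)])
      ultimately have "eventually (\<lambda>k. \<bar>u x\<bar> / 2 < \<bar>U k x\<bar> \<and> inverse (real (Suc k)) < \<bar>u x\<bar> / 2) sequentially"
        by eventually_elim simp
      then obtain N where N: "\<And>k. k \<ge> N \<Longrightarrow> \<bar>u x\<bar> / 2 < \<bar>U k x\<bar> \<and> inverse (real (Suc k)) < \<bar>u x\<bar> / 2"
        unfolding eventually_sequentially by blast
      have "inverse (real (Suc N)) \<le> \<bar>U k x\<bar>" if "k \<ge> N" for k
        using N[OF that] N[OF order_refl] by linarith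
      then have "x \<in> B N" by (simp add: B_def)
      then have "\<eta> x = g (u x)" using elim(1) by blast
      then show "\<eta> x = p * \<bar>u x\<bar> powr (p - 2) * u x" by (simp add: g_def)
    qed
  qed
qed

text \<open>Constant sequences serve as approximations, whatever the functional \<open>J\<close>
  is.\<close>

lemma frechet_subset_limiting_subdiff:
  assumes "u \<in> Leb_space M s" "s > 0"
  shows "frechet_subdiff M s r J u \<subseteq> limiting_subdiff M s r J u"
proof
  fix \<eta> assume \<eta>: "\<eta> \<in> frechet_subdiff M s r J u"
  have "Leb_converges M s (\<lambda>_. u) u" using assms by (simp add: Leb_converges_def Leb_norm_def)
  moreover have "Leb_converges_weakly M r (\<lambda>_. \<eta>) \<eta>" by (simp add: Leb_converges_weakly_def)
  moreover have "\<eta> \<in> Leb_space M r" using \<eta> by (simp add: frechet_subdiff_def)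
  ultimately show "\<eta> \<in> limiting_subdiff M s r J u"
    using \<eta> assms unfolding limiting_subdiff_def
    by (intro CollectI conjI exI[of _ "\<lambda>_. u"] exI[of _ "\<lambda>_. \<eta>"]) auto
qed

end

section \<open>Coincidence of both subdifferentials with the pointwise formula\<close>

theorem theorem4p6:
  fixes \<Omega> :: "'a::euclidean_space set" and p s r :: real and u :: "'a \<Rightarrow> real"
  assumes "\<Omega> \<in> sets lebesgue" and "0 < emeasure lebesgue \<Omega>" and "emeasure lebesgue \<Omega> < \<infinity>"
    and "0 < p" and "p < 1"
    and "1 < s" and "1 < r" and "1 / s + 1 / r = 1"
    and "u \<in> Leb_space (lebesgue_on \<Omega>) s"
  shows "limiting_subdiff (lebesgue_on \<Omega>) s r (q_fun (lebesgue_on \<Omega>) p) u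
           = frechet_subdiff (lebesgue_on \<Omega>) s r (q_fun (lebesgue_on \<Omega>) p) u
       \<and> frechet_subdiff (lebesgue_on \<Omega>) s r (q_fun (lebesgue_on \<Omega>) p) u
           = {\<eta> \<in> Leb_space (lebesgue_on \<Omega>) r.
               AE x in lebesgue_on \<Omega>. u x \<noteq> 0 \<longrightarrow> \<eta> x = p * \<bar>u x\<bar> powr (p - 2) * u x}"
proof -
  let ?M = "lebesgue_on \<Omega>"
  let ?R = "{\<eta> \<in> Leb_space ?M r. AE x in ?M. u x \<noteq> 0 \<longrightarrow> \<eta> x = p * \<bar>u x\<bar> powr (p - 2) * u x}"
  interpret finite_measure ?M
    using assms(1,3) by (intro finite_measureI) (simp add: emeasure_restrict_space)
  \<comment> \<open>Three inclusions close a cycle: limiting subdifferential, pointwise formula,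
    Frechet subdifferential, and back.\<close>
  have "limiting_subdiff ?M s r (q_fun ?M p) u \<subseteq> ?R"
    using limiting_subdiff_q_funD[OF assms(9) _ assms(4,5,7,6,8)]
    by (auto simp: limiting_subdiff_def)
  moreover have "?R \<subseteq> frechet_subdiff ?M s r (q_fun ?M p) u"
    using frechet_subdiff_q_funI[OF assms(9) _ assms(4,5,7,6,8)] by auto
  moreover have "frechet_subdiff ?M s r (q_fun ?M p) u \<subseteq> limiting_subdiff ?M s r (q_fun ?M p) u"
    using assms by (intro frechet_subset_limiting_subdiff) auto
  ultimately show ?thesis by blast
qed

end
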